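(* Let $T \subseteq \{n \in \mathbb{N} : n > 10,\ n \equiv 1 \pmod 3\}$ be an arbitrary set such that $$S = \{1,4,5,10\} \cup T$$ is infinite. Consider the subtraction game with subtraction set $S$, and for $g \in \mathbb{N}$ let $\mathcal{H}_g = \{u \in \mathbb{N} : \mathcal{G}(u) = g\}$ be the set of positions with SG value $g$. Put $$(S^{\geq 10} + 6) = \{s + 6 : s \in S,\ s \geq 10\} = \{16\} \cup \{t+6 : t \in T\}.$$ Then \begin{align*} \mathcal{H}_0 &= \{0,2,8\} \cup \{n \in \mathbb{N} : n > 10,\ n \equiv 2 \pmod 3\};\\ \mathcal{H}_1 &= \{1,3,9\} \cup \{n \in \mathbb{N} : n > 10,\ n \equiv 0 \pmod 3\};\\ \mathcal{H}_2 &= \{4,6\} \cup \bigl(\{n \in \mathbb{N} : n > 10,\ n \equiv 1 \pmod 3\} \setminus (S^{\geq 10}+6)\bigr);\\ \mathcal{H}_3 &= \{5,7\} \cup (S^{\geq 10}+6);\\ \mathcal{H}_4 &= \{10\};\\ \mathcal{H}_g &= \varnothing \quad \text{for all } g \geq 5. \end{align*}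
   Context: $\mathbb{N}$ denotes the nonnegative integers (including $0$). Given a nonempty set $S$ of positive integers (the subtraction set), the subtraction game with subtraction set $S$ is the impartial game whose positions are the natural numbers $u \in \mathbb{N}$ (a heap of $u$ tokens); a move removes $s$ tokens from the heap for some $s \in S$ with $s \leq u$, so the set of successors of $u$ is $\operatorname{next}(u) = \{u - s : s \in S,\ u - s \geq 0\}$. Two players alternate, and a player unable to move loses. The SG value (nim value) is defined recursively by $\mathcal{G}(u) = \operatorname{mex}(\{\mathcal{G}(u') : u' \in \operatorname{next}(u)\})$, where $\operatorname{mex}(N) = \min(\mathbb{N} \setminus N)$ is the smallest nonnegative integer not in $N$. *)

theory Defs
  imports Main
begin

definition mex :: "nat set \<Rightarrow> nat" where
  "mex N = (LEAST n. n \<notin> N)"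

(* A subtraction set consists of positive integers.  The guard 0 < s only serves to make the
   definition of sg_value terminate for every set S :: nat set. *)
definition next_positions :: "nat set \<Rightarrow> nat \<Rightarrow> nat set" where
  "next_positions S u = {u - s | s. s \<in> S \<and> 0 < s \<and> s \<le> u}"

lemma next_positions_eq:
  assumes "0 \<notin> S"
  shows "next_positions S u = {u - s | s. s \<in> S \<and> s \<le> u}"
proof -
  have "(s \<in> S \<and> 0 < s \<and> s \<le> u) = (s \<in> S \<and> s \<le> u)" for s
    using assms by (cases s) auto
  then show ?thesis
    unfolding next_positions_def by simp
qed

function sg_value :: "nat set \<Rightarrow> nat \<Rightarrow> nat" where
  "sg_value S u = mex ((\<lambda>v. sg_value S v) ` next_positions S u)"
  by pat_completeness auto
termination
  by (relation "measure snd") (auto simp: next_positions_def)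

declare sg_value.simps [simp del]

definition sg_level :: "nat set \<Rightarrow> nat \<Rightarrow> nat set" where
  "sg_level S g = {u. sg_value S u = g}"

end

theory Submission
  imports Defs
begin

text \<open>The recursion determines the SG values, so it suffices to verify the claimed values. Every
  \<open>s \<in> S\<close> other than \<open>5\<close> is \<open>1\<close> modulo \<open>3\<close>, hence beyond \<open>10\<close> the residues modulo \<open>3\<close> prevent the values
  \<open>0\<close> and \<open>1\<close> from reaching themselves, while the moves \<open>1\<close> and \<open>5\<close> supply the smaller
  values. On the class \<open>1\<close> modulo \<open>3\<close> the only position of value \<open>2\<close> that can be reached is \<open>6\<close>,
  by the move \<open>u - 6\<close>; it exists precisely when \<open>u \<in> R\<close>, and then the value is \<open>3\<close>.\<close>

lemma mex_eqI:
  assumes "g \<notin> N" "\<And>h. h < g \<Longrightarrow> h \<in> N"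
  shows "mex N = g"
  unfolding mex_def using assms by (intro Least_equality) (auto simp: not_less[symmetric])

text \<open>\<open>avoid\<close> keeps \<open>f u\<close> out of the values of the successors and
  \<open>reach\<close> puts every smaller number in, so strong induction identifies
  \<open>f u\<close> with the mex.\<close>

lemma sg_value_unique:
  assumes avoid: "\<And>u s. s \<in> S \<Longrightarrow> 0 < s \<Longrightarrow> s \<le> u \<Longrightarrow> f (u - s) \<noteq> f u"
    and reach: "\<And>u h. h < f u \<Longrightarrow> \<exists>s\<in>S. 0 < s \<and> s \<le> u \<and> f (u - s) = h"
  shows "sg_value S u = f u"
proof (induction u rule: less_induct)
  case (less u)
  have "sg_value S ` next_positions S u = f ` next_positions S u"
    by (intro image_cong refl less.IH) (auto simp: next_positions_def)
  moreover have "mex (f ` next_positions S u) = f u"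
  proof (rule mex_eqI)
    show "f u \<notin> f ` next_positions S u"
      using avoid by (fastforce simp: next_positions_def)
    show "h \<in> f ` next_positions S u" if "h < f u" for h
      using reach[OF that] unfolding next_positions_def by blast
  qed
  ultimately show ?case
    by (simp add: sg_value.simps[of S u])
qed

text \<open>The last branch collects \<open>4\<close>, \<open>6\<close> and the positions above
  \<open>10\<close> of residue 1 outside \<open>R\<close>.\<close>

definition claimed_value :: "nat set \<Rightarrow> nat \<Rightarrow> nat" where
  "claimed_value R u =
    (if u \<in> {0, 2, 8} \<or> u > 10 \<and> u mod 3 = 2 then 0
     else if u \<in> {1, 3, 9} \<or> u > 10 \<and> u mod 3 = 0 then 1
     else if u = 10 then 4
     else if u \<in> {5, 7} \<or> u \<in> R then 3
     else 2)"

text \<open>The bound \<open>s >= 10\<close> rules out \<open>5\<close>, the only move of residue 2,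
  and adding 6 preserves residues. So elements of \<open>R\<close> never fall into the branches for
  the values 0 and 1.\<close>

lemma shifted_mod:
  fixes S :: "nat set"
  assumes "\<And>s. s \<in> S \<Longrightarrow> s \<in> {1, 4, 5, 10} \<or> s > 10 \<and> s mod 3 = 1"
    and "r \<in> {s + 6 | s. s \<in> S \<and> s \<ge> 10}"
  shows "r \<ge> 16 \<and> r mod 3 = 1"
proof -
  obtain s where s: "s \<in> S" "s \<ge> 10" "r = s + 6"
    using assms(2) by auto
  then have "s mod 3 = 1"
    using assms(1)[OF s(1)] by auto
  then show ?thesis
    using s by presburger
qed

lemma le_10_cases:
  fixes u :: nat
  assumes "u \<le> 10"
  shows "u \<in> {0, 1, 2, 3, 4, 5, 6, 7, 8, 9, 10}"
  using assms by (auto simp: eval_nat_numeral le_Suc_eq)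

lemma claimed_value_le_10:
  assumes "\<And>r. r \<in> R \<Longrightarrow> r \<ge> 16"
  shows "claimed_value R 0 = 0" "claimed_value R (Suc 0) = 1" "claimed_value R 1 = 1"
    "claimed_value R (Suc (Suc 0)) = 0" "claimed_value R 2 = 0" "claimed_value R 3 = 1" "claimed_value R 4 = 2"
    "claimed_value R 5 = 3" "claimed_value R 6 = 2" "claimed_value R 7 = 3"
    "claimed_value R 8 = 0" "claimed_value R 9 = 1" "claimed_value R 10 = 4"
  using assms[of 4] assms[of 6] by (auto simp: claimed_value_def)

lemma claimed_value_gt_10:
  assumes "u > 10" "\<And>r. r \<in> R \<Longrightarrow> r mod 3 = 1"
  shows "claimed_value R u =
    (if u mod 3 = 2 then 0 else if u mod 3 = 0 then 1 else if u \<in> R then 3 else 2)"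
  using assms(1) assms(2)[of u] by (auto simp: claimed_value_def)

lemma claimed_value_avoid:
  assumes S: "\<And>s. s \<in> S \<Longrightarrow> s \<in> {1, 4, 5, 10} \<or> s > 10 \<and> s mod 3 = 1"
    and R: "R = {s + 6 | s. s \<in> S \<and> s \<ge> 10}"
    and s: "s \<in> S" "s \<le> u"
  shows "claimed_value R (u - s) \<noteq> claimed_value R u"
proof -
  have R_mod: "r \<ge> 16 \<and> r mod 3 = 1" if "r \<in> R" for r
    using shifted_mod[OF S] that unfolding R by simp
  \<comment> \<open>A long move ending at \<open>6\<close>, which has value 2, starts in
    \<open>R\<close>, where the value is 3.\<close>
  have six: "u \<in> R" if "u - s = 6" "10 \<le> s"
    unfolding R using that s by (intro CollectI exI[of _ s]) auto
  obtain v where u: "u = v + s"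
    using s by (metis le_add_diff_inverse2)
  then have u_minus: "u - s = v"
    by simp
  note small = claimed_value_le_10[OF R_mod[THEN conjunct1]]
  note large = claimed_value_gt_10[OF _ R_mod[THEN conjunct2]]
  show ?thesis
  proof (cases "s \<in> {1, 4, 5}")
    case True
    show ?thesis
    proof (cases "v \<le> 10")
      case v: True
      show ?thesis
        using le_10_cases[OF v] True unfolding u_minus unfolding u
        by (auto simp: small large split: if_splits)
    next
      case False
      have "v mod 3 = 0 \<or> v mod 3 = 1 \<or> v mod 3 = 2"
        by presburger
      \<comment> \<open>None of 1, 4, 5 is divisible by 3, and beyond 10 different residues carry
        different values.\<close>
      moreover have "u mod 3 = (v mod 3 + s mod 3) mod 3"
        by (simp add: u mod_add_eq)
      ultimately show ?thesis
        using False True by (elim disjE insertE emptyE; simp add: large u)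
    qed
  next
    case False
    then have s10: "s \<ge> 10" "s mod 3 = 1"
      using S[OF s(1)] by auto
    have um: "u mod 3 = (v mod 3 + 1) mod 3"
      using s10 by (metis u mod_add_eq mod_mod_trivial)
    have vm: "v mod 3 = 0 \<or> v mod 3 = 1 \<or> v mod 3 = 2"
      by presburger
    show ?thesis
    \<comment> \<open>At \<open>u = 10\<close> the bound \<open>s >= 10\<close> forces
      \<open>v = 0\<close>; the values are 4 and 0.\<close>
    proof (cases "u = 10")
      case True
      then show ?thesis
        using s10 u by (simp add: small)
    next
      case u10: False
      then have "u > 10"
        using s10 u by simp
      note cu = large[OF this]
      show ?thesis
      proof (cases "v \<le> 10")
        case True
        \<comment> \<open>The residue of \<open>v\<close> determines that of \<open>u\<close>. This
          settles all cases but \<open>v = 6\<close>: there \<open>u\<close> has residue 1 and could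
          have value 2, which \<open>six\<close> excludes.\<close>
        then show ?thesis
          using le_10_cases[OF True] um six s10 unfolding u[symmetric] insert_iff empty_iff
          by (elim disjE FalseE) (simp_all add: small cu u_minus split: if_splits)
      next
        case False
        then show ?thesis
          using vm um by (elim disjE) (simp_all add: cu large u_minus split: if_splits)
      qed
    qed
  qed
qed

text \<open>Up to 10 the four fixed moves suffice by inspection; beyond 10 the targets are
  \<open>u - 1\<close>, \<open>u - 5\<close> and, for \<open>u\<close> in \<open>R\<close>, the
  position \<open>6\<close>.\<close>

lemma claimed_value_reach:
  assumes sub: "{1, 4, 5, 10} \<subseteq> S"
    and R: "R = {s + 6 | s. s \<in> S \<and> s \<ge> 10}"
    and h: "h < claimed_value R u"
  shows "\<exists>s\<in>S. 0 < s \<and> s \<le> u \<and> claimed_value R (u - s) = h"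
proof -
  have R_small: "w \<notin> R" if "w < 16" for w
    using that unfolding R by auto
  then have "16 \<le> r" if "r \<in> R" for r
    using that by (meson not_less)
  note small = claimed_value_le_10[OF this]
  have less: "k < 2 \<longleftrightarrow> k = 0 \<or> k = 1" "k < 3 \<longleftrightarrow> k = 0 \<or> k = 1 \<or> k = 2"
    "k < 4 \<longleftrightarrow> k = 0 \<or> k = 1 \<or> k = 2 \<or> k = 3" for k :: nat
    by auto
  have S: "1 \<in> S" "5 \<in> S"
    using sub by auto
  show ?thesis
  proof (cases "u \<le> 10")
    case True
    then have "u \<in> {0, 1, 2, 3, 4, 5, 6, 7, 8, 9, 10}"
      by (rule le_10_cases)
    \<comment> \<open>At \<open>u = 10\<close> all four moves are needed: they lead to 9, 6, 5, 0,
      with values 1, 2, 3, 0.\<close>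
    then have "\<exists>s\<in>{1, 4, 5, 10}. s \<le> u \<and> claimed_value R (u - s) = h"
      using h unfolding insert_iff empty_iff
      by (elim disjE FalseE) (auto simp: small less)
    then obtain s where s: "s \<in> {1, 4, 5, 10}" "s \<le> u" "claimed_value R (u - s) = h"
      by blast
    moreover have "0 < s"
      using s(1) by auto
    ultimately show ?thesis
      using sub by blast
  next
    case False
    consider "u mod 3 = 2" | "u mod 3 = 0" | "u mod 3 = 1"
      by linarith
    then show ?thesis
    proof cases
      case 1
      then show ?thesis
        using h False by (simp add: claimed_value_def)
    next
      case 2
      have "u = 3 * (u div 3)"
        using 2 by auto
      then have "u = 3 * (u div 3 - 1) + 3"
        using False by linarith
      then obtain k where k: "u = 3 * k + 3"
        by blast
      \<comment> \<open>The first multiple of 3 beyond 10 is 12, so \<open>u - 1\<close> is at least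
        11.\<close>
      then have "u - 1 > 10"
        using False by presburger
      have "u - 1 = 3 * k + 2"
        using k by simp
      then have "(u - 1) mod 3 = 2 mod 3"
        by (simp only: mod_mult_self4)
      then have "(u - 1) mod 3 = 2"
        by simp
      then have "claimed_value R (u - 1) = 0"
        using \<open>u - 1 > 10\<close> by (simp add: claimed_value_def)
      moreover have "h = 0"
        using h 2 False by (simp add: claimed_value_def split: if_splits)
      ultimately show ?thesis
        using S(1) False by (intro bexI[of _ 1]) auto
    next
      case 3
      have "u = 3 * (u div 3) + 1"
        using mult_div_mod_eq[of 3 u] 3 by simp
      \<comment> \<open>The offset 7 keeps both \<open>u - 1\<close> and \<open>u - 5\<close> free
        of truncated subtraction.\<close>
      then have "u = 3 * (u div 3 - 2) + 7"
        using False by linarith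
      then obtain k where k: "u = 3 * k + 7"
        by blast
      then have u: "u \<ge> 13"
        using False by presburger
      have "u - 1 = 3 * (k + 2) + 0" "u - 5 = 3 * k + 2"
        using k by simp_all
      then have "(u - 1) mod 3 = 0 mod 3" "(u - 5) mod 3 = 2 mod 3"
        by (simp_all only: mod_mult_self4)
      then have m: "(u - 1) mod 3 = 0" "(u - 5) mod 3 = 2"
        by simp_all
      \<comment> \<open>For \<open>u = 13\<close> the move 5 lands on the exceptional zero
        \<open>8\<close>; from \<open>u = 16\<close> on it lands at 11 or beyond.\<close>
      have "u - 5 = 8 \<or> u - 5 > 10"
        using k u by presburger
      then have v0: "claimed_value R (u - 5) = 0"
        using m by (auto simp: claimed_value_def)
      have v1: "claimed_value R (u - 1) = 1"
        using m u by (auto simp: claimed_value_def)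
      have v2: "\<exists>s\<in>S. 0 < s \<and> s \<le> u \<and> claimed_value R (u - s) = 2" if uR: "u \<in> R"
      proof -
        \<comment> \<open>The witness is the move \<open>u - 6\<close>; its target \<open>6\<close>
          lies outside \<open>R\<close> and so has value 2.\<close>
        obtain s where "s \<in> S" "s \<ge> 10" "u = s + 6"
          using uR unfolding R by auto
        then show ?thesis
          using R_small[of 6] by (intro bexI[of _ s]) (auto simp: claimed_value_def)
      qed
      have "h = 0 \<or> h = 1 \<or> h = 2 \<and> u \<in> R"
        using h 3 u by (auto simp: claimed_value_def split: if_splits)
      then show ?thesis
      proof (elim disjE conjE)
        show ?thesis if "h = 0"
          using that v0 S(2) u by (intro bexI[of _ 5]) auto
        show ?thesis if "h = 1"
          using that v1 S(1) u by (intro bexI[of _ 1]) auto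
        show ?thesis if "h = 2" "u \<in> R"
          using that v2 by blast
      qed
    qed
  qed
qed

theorem proposition4p1:
  fixes T S R :: "nat set"
  assumes "T \<subseteq> {n. n > 10 \<and> n mod 3 = 1}"
    and "S = {1, 4, 5, 10} \<union> T"
    and "infinite S"
    and "R = {s + 6 | s. s \<in> S \<and> s \<ge> 10}"
  shows "R = {16} \<union> {t + 6 | t. t \<in> T}
    \<and> sg_level S 0 = {0, 2, 8} \<union> {n. n > 10 \<and> n mod 3 = 2}
    \<and> sg_level S 1 = {1, 3, 9} \<union> {n. n > 10 \<and> n mod 3 = 0}
    \<and> sg_level S 2 = {4, 6} \<union> ({n. n > 10 \<and> n mod 3 = 1} - R)
    \<and> sg_level S 3 = {5, 7} \<union> R
    \<and> sg_level S 4 = {10}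
    \<and> (\<forall>g\<ge>5. sg_level S g = {})"
proof -
  have S: "s \<in> {1, 4, 5, 10} \<or> s > 10 \<and> s mod 3 = 1" if "s \<in> S" for s
    using assms(1,2) that by auto
  have sub: "{1, 4, 5, 10} \<subseteq> S"
    using assms(2) by auto
  have val: "sg_value S u = claimed_value R u" for u
    using claimed_value_avoid[OF S assms(4)] claimed_value_reach[OF sub assms(4)]
    by (intro sg_value_unique) auto
  \<comment> \<open>Among the four fixed moves only \<open>10\<close> reaches the bound, which gives
    16.\<close>
  have R: "R = {16} \<union> {t + 6 | t. t \<in> T}"
    using assms(1) unfolding assms(4,2) by fastforce
  have R_mod: "r \<ge> 16 \<and> r mod 3 = 1" if "r \<in> R" for r
    using shifted_mod[OF S] that unfolding assms(4) by simp
  have small: "u \<in> {0, 1, 2, 3, 4, 5, 6, 7, 8, 9, 10}" if "\<not> 10 < u" for u :: nat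
    using le_10_cases[of u] that by simp
  have m: "u mod 3 = 0 \<or> u mod 3 = 1 \<or> u mod 3 = 2" for u :: nat
    by presburger
  have level: "u \<in> sg_level S g \<longleftrightarrow> claimed_value R u = g" for u g
    by (simp add: sg_level_def val)
  have "sg_level S 0 = {0, 2, 8} \<union> {n. n > 10 \<and> n mod 3 = 2}"
    by (rule set_eqI) (auto simp: level claimed_value_def)
  moreover have "sg_level S 1 = {1, 3, 9} \<union> {n. n > 10 \<and> n mod 3 = 0}"
    by (rule set_eqI) (auto simp: level claimed_value_def)
  moreover have "sg_level S 2 = {4, 6} \<union> ({n. n > 10 \<and> n mod 3 = 1} - R)"
  proof (rule set_eqI)
    fix u
    \<comment> \<open>Value 2 is the default branch, so all positions up to 10 and all residues have
      to be listed.\<close>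
    show "u \<in> sg_level S 2 \<longleftrightarrow> u \<in> {4, 6} \<union> ({n. n > 10 \<and> n mod 3 = 1} - R)"
      using small[of u] m[of u] R_mod[of u] by (cases "10 < u") (auto simp: level claimed_value_def)
  qed
  moreover have "sg_level S 3 = {5, 7} \<union> R"
  proof (rule set_eqI)
    fix u
    show "u \<in> sg_level S 3 \<longleftrightarrow> u \<in> {5, 7} \<union> R"
      using R_mod[of u] by (auto simp: level claimed_value_def)
  qed
  moreover have "sg_level S 4 = {10}"
    by (rule set_eqI) (auto simp: level claimed_value_def)
  moreover have "\<forall>g\<ge>5. sg_level S g = {}"
    by (auto simp: level claimed_value_def split: if_splits)
  ultimately show ?thesis
    using R by blast
qed

end
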